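(* Let $(A,\cdot)$ be a $\mathbf{k}$-algebra and let $f,g$ be commuting semi-homomorphisms on $A$: $fg=gf$. Define $$x\ast y:=f(x)\cdot y\ (=f(x\cdot y)=x\cdot f(y)),\qquad x\odot y:=g(x)\cdot y\ (=g(x\cdot y)=x\cdot g(y)),\qquad \forall x,y\in A.$$ Then $(A,\ast,\odot)$ is a totally compatible dialgebra. In particular, for any semi-homomorphism $f$ on $A$, define $$x\ast y:=x\cdot y,\qquad x\odot y:=f(x)\cdot y,\qquad \forall x,y\in A.$$ Then $(A,\ast,\odot)$ is a totally compatible dialgebra.
   Context: $\mathbf{k}$ is a commutative unitary ring; $\mathbf{k}$-algebras are associative and not assumed unitary. A semi-homomorphism of a $\mathbf{k}$-algebra $(A,\cdot)$ is a linear map $f:A\to A$ such that $f(x\cdot y)=x\cdot f(y)=f(x)\cdot y$ for all $x,y\in A$. A totally compatible dialgebra is a $\mathbf{k}$-module $R$ with two bilinear binary operations $\ast,\odot$ that are both associative and satisfy $(a\ast b)\odot c=a\ast(b\odot c)=(a\odot b)\ast c=a\odot(b\ast c)$ for all $a,b,c\in R$. *)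

theory Defs
  imports "HOL-Algebra.Module"
begin

definition linear_map ::
    "('k, 'r) ring_scheme \<Rightarrow> ('k, 'a, 'm) module_scheme \<Rightarrow> ('k, 'b, 'n) module_scheme
      \<Rightarrow> ('a \<Rightarrow> 'b) \<Rightarrow> bool" where
  "linear_map k M N f \<longleftrightarrow>
     f \<in> hom (add_monoid M) (add_monoid N) \<and>
     (\<forall>a\<in>carrier k. \<forall>x\<in>carrier M. f (a \<odot>\<^bsub>M\<^esub> x) = a \<odot>\<^bsub>N\<^esub> f x)"

definition bilinear_operation ::
    "('k, 'r) ring_scheme \<Rightarrow> ('k, 'a, 'm) module_scheme \<Rightarrow> ('a \<Rightarrow> 'a \<Rightarrow> 'a) \<Rightarrow> bool" where
  "bilinear_operation k M p \<longleftrightarrow>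
     (\<forall>x\<in>carrier M. linear_map k M M (\<lambda>y. p x y)) \<and>
     (\<forall>y\<in>carrier M. linear_map k M M (\<lambda>x. p x y))"

text \<open>
  The library locale \<^locale>\<open>algebra\<close> requires a commutative, unital product.
  Here the product is a separate parameter, so that several products can live on
  one module; the ring multiplication and unit fields of the record \<open>M\<close> play no role.
\<close>

locale associative_algebra = module k M
  for k :: "('k, 'r) ring_scheme" and M :: "('k, 'a, 'm) module_scheme" +
  fixes dot :: "'a \<Rightarrow> 'a \<Rightarrow> 'a"
  assumes dot_bilinear: "bilinear_operation k M dot"
    and dot_assoc:
      "\<lbrakk>x \<in> carrier M; y \<in> carrier M; z \<in> carrier M\<rbrakk>
        \<Longrightarrow> dot (dot x y) z = dot x (dot y z)"

definition semi_homomorphism ::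
    "('k, 'r) ring_scheme \<Rightarrow> ('k, 'a, 'm) module_scheme \<Rightarrow> ('a \<Rightarrow> 'a \<Rightarrow> 'a)
      \<Rightarrow> ('a \<Rightarrow> 'a) \<Rightarrow> bool" where
  "semi_homomorphism k A dot f \<longleftrightarrow>
     linear_map k A A f \<and>
     (\<forall>x\<in>carrier A. \<forall>y\<in>carrier A.
        f (dot x y) = dot x (f y) \<and> dot x (f y) = dot (f x) y)"

locale totally_compatible_dialgebra = module k R
  for k :: "('k, 'r) ring_scheme" and R :: "('k, 'a, 'm) module_scheme" +
  fixes ast :: "'a \<Rightarrow> 'a \<Rightarrow> 'a" and odot :: "'a \<Rightarrow> 'a \<Rightarrow> 'a"
  assumes ast_bilinear: "bilinear_operation k R ast"
    and odot_bilinear: "bilinear_operation k R odot"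
    and ast_assoc:
      "\<lbrakk>a \<in> carrier R; b \<in> carrier R; c \<in> carrier R\<rbrakk>
        \<Longrightarrow> ast (ast a b) c = ast a (ast b c)"
    and odot_assoc:
      "\<lbrakk>a \<in> carrier R; b \<in> carrier R; c \<in> carrier R\<rbrakk>
        \<Longrightarrow> odot (odot a b) c = odot a (odot b c)"
    and totally_compatible:
      "\<lbrakk>a \<in> carrier R; b \<in> carrier R; c \<in> carrier R\<rbrakk>
        \<Longrightarrow> odot (ast a b) c = ast a (odot b c) \<and>
            ast a (odot b c) = ast (odot a b) c \<and>
            ast (odot a b) c = odot a (ast b c)"

end

theory Submission
  imports Defs
begin

text \<open>
  A semi-homomorphism can be moved freely between a product and either of its factors.
  Hence in any product of three factors \<open>a\<close>, \<open>b\<close>, \<open>c\<close> built from the operations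
  \<open>f x \<cdot> y\<close> and \<open>g x \<cdot> y\<close>, the two maps can be pulled out to the front, leaving
  a composite of them applied to \<open>a \<cdot> b \<cdot> c\<close>. The dialgebra axioms then compare
  only the composites: the associative laws involve \<open>f \<circ> f\<close> or \<open>g \<circ> g\<close> on both sides,
  and the mixed laws involve \<open>f \<circ> g\<close> or \<open>g \<circ> f\<close>, which agree on the carrier. The two lemmas
  \<open>left_bracketed_product\<close> and \<open>right_bracketed_product\<close> carry out the pulling.
  The second claim is the case where the first map is the identity.
\<close>

lemma linear_map_closed:
  assumes "linear_map k M N f" "x \<in> carrier M"
  shows "f x \<in> carrier N"
  using assms by (auto simp: linear_map_def hom_def)

lemma linear_map_id: "linear_map k M M (\<lambda>x. x)"
  by (auto simp: linear_map_def hom_def)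

lemma linear_map_compose:
  assumes "linear_map k L M f" "linear_map k M N g"
  shows "linear_map k L N (\<lambda>x. g (f x))"
  using assms by (auto simp: linear_map_def hom_def Pi_iff)

lemma semi_homomorphism_linear:
  assumes "semi_homomorphism k A dot f"
  shows "linear_map k A A f"
  using assms by (simp add: semi_homomorphism_def)

lemma semi_homomorphism_pull_out:
  assumes "semi_homomorphism k A dot f" "x \<in> carrier A" "y \<in> carrier A"
  shows "dot (f x) y = f (dot x y)" and "dot x (f y) = f (dot x y)"
  using assms by (simp_all add: semi_homomorphism_def)

context associative_algebra
begin

lemma dot_closed:
  assumes "x \<in> carrier M" "y \<in> carrier M"
  shows "dot x y \<in> carrier M"
  using dot_bilinear assms linear_map_closed unfolding bilinear_operation_def by fast

lemma semi_homomorphism_id: "semi_homomorphism k M dot (\<lambda>x. x)"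
  by (simp add: semi_homomorphism_def linear_map_id)

lemma semi_homomorphism_closed:
  assumes "semi_homomorphism k M dot f" "x \<in> carrier M"
  shows "f x \<in> carrier M"
  using assms by (blast intro: linear_map_closed semi_homomorphism_linear)

lemma twisted_bilinear:
  assumes f: "semi_homomorphism k M dot f"
  shows "bilinear_operation k M (\<lambda>x y. dot (f x) y)"
  unfolding bilinear_operation_def
proof (intro conjI ballI)
  fix x assume "x \<in> carrier M"
  then show "linear_map k M M (\<lambda>y. dot (f x) y)"
    using dot_bilinear semi_homomorphism_closed[OF f] by (simp add: bilinear_operation_def)
next
  fix y assume "y \<in> carrier M"
  then show "linear_map k M M (\<lambda>x. dot (f x) y)"
    using dot_bilinear
    by (intro linear_map_compose[OF semi_homomorphism_linear[OF f], where g = "\<lambda>x. dot x y"])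
      (simp add: bilinear_operation_def)
qed

lemma left_bracketed_product:
  assumes f: "semi_homomorphism k M dot f" and g: "semi_homomorphism k M dot g"
    and "a \<in> carrier M" "b \<in> carrier M" "c \<in> carrier M"
  shows "dot (g (dot (f a) b)) c = g (f (dot a (dot b c)))"
  using assms(3-)
  by (simp add: semi_homomorphism_pull_out[OF f] semi_homomorphism_pull_out[OF g]
      semi_homomorphism_closed[OF f] dot_closed dot_assoc)

text \<open>
  Compared with the left bracketing, the same order of operations produces the
  composite in the opposite order; commutation of \<open>f\<close> and \<open>g\<close> reconciles the two.
\<close>

lemma right_bracketed_product:
  assumes f: "semi_homomorphism k M dot f" and g: "semi_homomorphism k M dot g"
    and "a \<in> carrier M" "b \<in> carrier M" "c \<in> carrier M"
  shows "dot (f a) (dot (g b) c) = f (g (dot a (dot b c)))"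
  using assms(3-)
  by (simp add: semi_homomorphism_pull_out[OF f] semi_homomorphism_pull_out[OF g]
      semi_homomorphism_closed[OF g] dot_closed)

lemma commuting_semi_homomorphisms_dialgebra:
  assumes f: "semi_homomorphism k M dot f" and g: "semi_homomorphism k M dot g"
    and comm: "\<And>x. x \<in> carrier M \<Longrightarrow> f (g x) = g (f x)"
  shows "totally_compatible_dialgebra k M (\<lambda>x y. dot (f x) y) (\<lambda>x y. dot (g x) y)"
proof
  fix a b c
  assume abc: "a \<in> carrier M" "b \<in> carrier M" "c \<in> carrier M"
  show "dot (f (dot (f a) b)) c = dot (f a) (dot (f b) c)"
    using abc by (simp add: left_bracketed_product[OF f f] right_bracketed_product[OF f f])
  show "dot (g (dot (g a) b)) c = dot (g a) (dot (g b) c)"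
    using abc by (simp add: left_bracketed_product[OF g g] right_bracketed_product[OF g g])
  show "dot (g (dot (f a) b)) c = dot (f a) (dot (g b) c) \<and>
        dot (f a) (dot (g b) c) = dot (f (dot (g a) b)) c \<and>
        dot (f (dot (g a) b)) c = dot (g a) (dot (f b) c)"
    using abc
    by (simp add: left_bracketed_product[OF f g] left_bracketed_product[OF g f]
        right_bracketed_product[OF f g] right_bracketed_product[OF g f] comm dot_closed)
qed (use f g in \<open>simp_all add: twisted_bilinear\<close>)

end

theorem proposition2p7:
  fixes k :: "('k, 'r) ring_scheme"
    and A :: "('k, 'a, 'm) module_scheme"
    and dot :: "'a \<Rightarrow> 'a \<Rightarrow> 'a"
  assumes "associative_algebra k A dot"
  shows
    "(\<forall>f g. semi_homomorphism k A dot f \<longrightarrow> semi_homomorphism k A dot g \<longrightarrow>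
        (\<forall>x\<in>carrier A. f (g x) = g (f x)) \<longrightarrow>
        (\<forall>x\<in>carrier A. \<forall>y\<in>carrier A.
           dot (f x) y = f (dot x y) \<and> f (dot x y) = dot x (f y) \<and>
           dot (g x) y = g (dot x y) \<and> g (dot x y) = dot x (g y)) \<and>
        totally_compatible_dialgebra k A (\<lambda>x y. dot (f x) y) (\<lambda>x y. dot (g x) y)) \<and>
     (\<forall>f. semi_homomorphism k A dot f \<longrightarrow>
        totally_compatible_dialgebra k A dot (\<lambda>x y. dot (f x) y))"
proof -
  interpret associative_algebra k A dot
    by (fact assms)
  show ?thesis
    using commuting_semi_homomorphisms_dialgebra
      commuting_semi_homomorphisms_dialgebra[OF semi_homomorphism_id]
    by (simp add: semi_homomorphism_pull_out)
qed

end
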